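(* $c:=\inf_{\theta\in\mathbb{F}_q((1/t))}\ \sup_{\gamma\in\mathbb{F}_q((1/t))}\ \inf_{0\ne N\in\mathbb{F}_q[t]}|N|\cdot|\langle N\theta-\gamma\rangle|=q^{-2}$.
   Context: $q$ is a prime power, $\mathbb{F}_q[t]$ the polynomial ring over $\mathbb{F}_q$, and $\mathbb{F}_q((1/t))$ the field of Laurent series $\theta=\sum_i\theta_it^{-i}$ with finitely many nonzero coefficients of positive powers of $t$. Absolute value: $|\theta|=q^{\deg\theta}$ with $\deg\theta=\max\{-i:\theta_i\ne0\}$, $|0|=0$. Fractional part: $\langle\theta\rangle=\sum_{i\ge1}\theta_it^{-i}$. *)

theory Defs
  imports Complex_Main "HOL-Library.Cardinality" "HOL-Computational_Algebra.Computational_Algebra"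
begin

unbundle fps_syntax

text \<open>
  The field \<open>F\<^sub>q((1/t))\<close> is the type \<open>'a fls\<close> of formal Laurent series over a finite field \<open>'a\<close>
  with \<open>q = CARD('a)\<close> elements, the formal variable \<^const>\<open>fls_X\<close> being \<open>1/t\<close>. Thus \<open>\<theta> $$ i\<close> is
  the coefficient of \<open>t\<close> to the power \<open>-i\<close>, the indeterminate \<open>t\<close> is \<^const>\<open>fls_X_inv\<close>, and
  \<open>deg \<theta> = - fls_subdegree \<theta>\<close> for nonzero \<open>\<theta>\<close>.
\<close>

definition poly_to_fls :: "'a::comm_ring_1 poly \<Rightarrow> 'a fls" where
  "poly_to_fls N = poly (map_poly fls_const N) fls_X_inv"

definition fls_abs :: "'a::{field,finite} fls \<Rightarrow> real" where
  "fls_abs \<theta> = (if \<theta> = 0 then 0 else real CARD('a) powi (- fls_subdegree \<theta>))"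

definition fls_frac :: "'a::zero fls \<Rightarrow> 'a fls" where
  "fls_frac \<theta> = fps_to_fls (Abs_fps (\<lambda>n. if n = 0 then 0 else \<theta> $$ int n))"

lemma fls_frac_nth: "fls_frac \<theta> $$ i = (if 1 \<le> i then \<theta> $$ i else 0)"
  by (simp add: fls_frac_def)

lemma poly_to_fls_nth: "poly_to_fls N $$ i = (if i \<le> 0 then coeff N (nat (- i)) else 0)"
proof -
  have c: "degree (map_poly fls_const N) = degree N"
    by (intro degree_map_poly) simp
  have "poly_to_fls N = (\<Sum>j\<le>degree N. fls_const (coeff N j) * fls_X_inv ^ j)"
    by (simp add: poly_to_fls_def poly_altdef c coeff_map_poly)
  then have "poly_to_fls N $$ i = (\<Sum>j\<le>degree N. coeff N j * (if i = - int j then 1 else 0))"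
    by (simp add: fls_nth_sum)
  also have "\<dots> = (\<Sum>j\<le>degree N. if j = nat (- i) \<and> i \<le> 0 then coeff N j else 0)"
    by (intro sum.cong) auto
  also have "\<dots> = (if i \<le> 0 then coeff N (nat (- i)) else 0)"
    by (auto simp: not_le coeff_eq_0)
  finally show ?thesis .
qed

text \<open>
  Every infimum and supremum in the statement is that of a nonempty bounded set of reals, so the
  conditionally complete \<^const>\<open>Inf\<close> and \<^const>\<open>Sup\<close> have their usual meaning: all values are
  nonnegative, and the two lemmas below, the first with \<open>N = 1\<close>, bound the inner infimum by 1.
\<close>

lemma fls_abs_nonneg: "0 \<le> fls_abs \<theta>"
  by (simp add: fls_abs_def)

lemma fls_abs_frac_le_1: "fls_abs (fls_frac (\<theta> :: 'a::{field,finite} fls)) \<le> 1"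
proof (cases "fls_frac \<theta> = 0")
  case False
  then have "0 \<le> fls_subdegree (fls_frac \<theta>)"
    by (metis fls_frac_nth nth_fls_subdegree_nonzero not_one_le_zero linorder_le_cases order_trans)
  moreover have "1 \<le> real CARD('a)"
    by (simp add: Suc_leI)
  ultimately show ?thesis
    using False by (simp add: fls_abs_def power_int_def divide_simps one_le_power)
qed (simp add: fls_abs_def)

lemma fls_abs_one: "fls_abs (poly_to_fls (1 :: 'a::{field,finite} poly)) = 1"
  by (simp add: poly_to_fls_def fls_abs_def)

end

theory Submission
  imports Defs
begin

text \<open>
  Call a nonzero \<open>L\<close> of minimal degree among those for which the coefficients of
  \<open>t\<^sup>-\<^sup>1, \<dots>, t\<^sup>-\<^sup>m\<close> in \<open>L \<theta>\<close> vanish an \<open>m\<close>-th denominator; \<open>deg L \<le> m\<close> by pigeonhole.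
  Two monic denominators (for any two values of \<open>m\<close>) of the same degree coincide, so the coefficients
  of \<open>\<gamma>\<close> can be chosen one after the other such that the residue (coefficient of \<open>t\<^sup>-\<^sup>1\<close>) of \<open>L \<gamma>\<close>
  is 1 for every monic denominator \<open>L\<close>. If \<open>deg N = n\<close> and \<open>|\<langle>N \<theta> - \<gamma>\<rangle>| < q\<^sup>-\<^sup>n\<^sup>-\<^sup>2\<close>, then for an
  \<open>(n+1)\<close>-st denominator \<open>L\<close> both \<open>L (N \<theta> - \<gamma>)\<close> and \<open>N (L \<theta>)\<close> have residue 0, a contradiction.

  Conversely, let \<open>\<theta>\<close> be the sum of \<open>t^(-2^k)\<close> over \<open>k \<ge> 1\<close>. For \<open>m = 2\<^sup>k\<close> the \<open>m \<times> m\<close> Hankel matrix of \<open>\<theta>\<close> is unitriangular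
  with respect to its antidiagonal, so some \<open>N\<close> of degree less than \<open>m\<close> makes \<open>N \<theta>\<close> and \<open>\<gamma>\<close> agree
  in the coefficients of \<open>t\<^sup>-\<^sup>1, \<dots>, t\<^sup>-\<^sup>m\<close>, whence \<open>|N| |\<langle>N \<theta> - \<gamma>\<rangle>| \<le> q\<^sup>m\<^sup>-\<^sup>1 q\<^sup>-\<^sup>m\<^sup>-\<^sup>1\<close>. If \<open>\<langle>\<gamma>\<rangle> \<noteq> 0\<close> then \<open>N \<noteq> 0\<close> for large \<open>k\<close>; if \<open>\<langle>\<gamma>\<rangle> = 0\<close> then \<open>N = 1\<close> does, since
  \<open>\<theta>\<close> has residue 0.
\<close>

section \<open>Coefficients and absolute values of polynomials inside the Laurent series
  field\<close>

lemma poly_to_fls_diff: "poly_to_fls (L - M) = poly_to_fls L - poly_to_fls M"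
  by (rule fls_eqI) (simp add: poly_to_fls_nth)

lemma poly_to_fls_smult: "poly_to_fls (smult c L) = fls_const c * poly_to_fls L"
  by (rule fls_eqI) (simp add: poly_to_fls_nth)

text \<open>Multiplication by \<open>t^j\<close> shifts coefficients by \<open>j\<close>. The upper
  limit \<open>n\<close> may exceed the degree, so a degree bound on \<open>N\<close> suffices to
  expand the product.\<close>

lemma poly_to_fls_times_nth:
  assumes "degree N \<le> n"
  shows "(poly_to_fls N * f) $$ i = (\<Sum>j\<le>n. coeff N j * f $$ (i + int j))"
proof -
  have "poly_to_fls N = (\<Sum>j\<le>degree N. fls_const (coeff N j) * fls_X_inv ^ j)"
    by (simp add: poly_to_fls_def poly_altdef coeff_map_poly degree_map_poly)
  moreover have "(fls_const c * fls_X_inv ^ j * f) $$ i = c * f $$ (i + int j)" for c j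
    by (simp only: mult.assoc fls_X_inv_power_times_conv_shift(1) fls_mult_const_nth fls_shift_nth)
  ultimately have "(poly_to_fls N * f) $$ i = (\<Sum>j\<le>degree N. coeff N j * f $$ (i + int j))"
    by (simp only: sum_distrib_right fls_nth_sum)
  also have "\<dots> = (\<Sum>j\<le>n. coeff N j * f $$ (i + int j))"
    using assms by (intro sum.mono_neutral_left) (auto simp: coeff_eq_0)
  finally show ?thesis .
qed

lemma fls_abs_poly_to_fls:
  assumes "N \<noteq> 0"
  shows "fls_abs (poly_to_fls N :: 'a::{field,finite} fls) = real CARD('a) powi int (degree N)"
proof -
  have nz: "poly_to_fls N $$ (- int (degree N)) \<noteq> 0"
    using assms by (simp add: poly_to_fls_nth)
  have "fls_subdegree (poly_to_fls N) = - int (degree N)"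
    by (rule fls_subdegree_eqI[OF nz]) (auto simp: poly_to_fls_nth intro!: coeff_eq_0)
  with nz show ?thesis
    by (auto simp: fls_abs_def)
qed

lemma fls_abs_frac_le:
  fixes f :: "'a::{field,finite} fls"
  assumes "\<And>i. 1 \<le> i \<Longrightarrow> i \<le> int m \<Longrightarrow> f $$ i = 0"
  shows "fls_abs (fls_frac f) \<le> real CARD('a) powi (- int m - 1)"
proof (cases "fls_frac f = 0")
  case False
  have "int m + 1 \<le> fls_subdegree (fls_frac f)"
    using False by (intro fls_subdegree_geI) (auto simp: fls_frac_nth assms)
  then show ?thesis
    using False by (auto simp: fls_abs_def Suc_leI intro!: power_int_increasing)
qed (simp add: fls_abs_def)

lemma fls_nth_eq_0_if_abs_frac_less:
  fixes f :: "'a::{field,finite} fls"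
  assumes "fls_abs (fls_frac f) < real CARD('a) powi (- k)" "1 \<le> i" "i \<le> k"
  shows "f $$ i = 0"
proof (rule ccontr)
  assume "f $$ i \<noteq> 0"
  then have nz: "fls_frac f $$ i \<noteq> 0"
    using assms by (simp add: fls_frac_nth)
  then have "fls_subdegree (fls_frac f) \<le> k"
    using fls_subdegree_leI[OF nz] assms(3) by simp
  then have "real CARD('a) powi (- k) \<le> fls_abs (fls_frac f)"
    using nz by (auto simp: fls_abs_def Suc_leI intro!: power_int_increasing)
  with assms show False
    by simp
qed

subsection \<open>The lower bound\<close>

text \<open>Equivalent to \<open>|<L \<theta>>| < q^(-m)\<close>; the form by coefficients makes it
  visibly linear in \<open>L\<close>.\<close>

definition fls_annihilates :: "'a::comm_ring_1 fls \<Rightarrow> nat \<Rightarrow> 'a poly \<Rightarrow> bool" where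
  "fls_annihilates \<theta> m L \<longleftrightarrow> (\<forall>i. 1 \<le> i \<and> i \<le> int m \<longrightarrow> (poly_to_fls L * \<theta>) $$ i = 0)"

lemma fls_annihilates_mono: "fls_annihilates \<theta> m' L \<Longrightarrow> m \<le> m' \<Longrightarrow> fls_annihilates \<theta> m L"
  by (auto simp: fls_annihilates_def)

lemma fls_annihilates_diff:
  "fls_annihilates \<theta> m L \<Longrightarrow> fls_annihilates \<theta> m M \<Longrightarrow> fls_annihilates \<theta> m (L - M)"
  by (simp add: fls_annihilates_def poly_to_fls_diff left_diff_distrib)

lemma fls_annihilates_smult: "fls_annihilates \<theta> m L \<Longrightarrow> fls_annihilates \<theta> m (smult c L)"
  by (simp add: fls_annihilates_def poly_to_fls_smult mult.assoc)

text \<open>The \<open>q^(m+1)\<close> coefficient lists yield at most \<open>q^m\<close> lists of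
  values, so two of them yield the same one; \<open>L\<close> is the difference of their
  polynomials.\<close>

lemma ex_fls_annihilates:
  fixes \<theta> :: "'a::{field,finite} fls"
  shows "\<exists>L. L \<noteq> 0 \<and> degree L \<le> m \<and> fls_annihilates \<theta> m L"
proof -
  define A where "A = {xs :: 'a list. set xs \<subseteq> UNIV \<and> length xs = Suc m}"
  define B where "B = {xs :: 'a list. set xs \<subseteq> UNIV \<and> length xs = m}"
  define F where "F xs = map (\<lambda>i. (poly_to_fls (Poly xs) * \<theta>) $$ (int i + 1)) [0..<m]" for xs
  have "finite B"
    unfolding B_def by (rule finite_lists_length_eq) simp
  have "1 < CARD('a)"
    using card_mono[of UNIV "{0, 1 :: 'a}"] by simp
  then have "card B < card A"
    unfolding A_def B_def by (subst (1 2) card_lists_length_eq) auto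
  moreover have "F ` A \<subseteq> B"
    by (auto simp: F_def B_def)
  ultimately have "\<not> inj_on F A"
    using \<open>finite B\<close> card_inj_on_le by (metis not_less)
  then obtain xs ys where *: "xs \<in> A" "ys \<in> A" "xs \<noteq> ys" "F xs = F ys"
    by (auto simp: inj_on_def)
  have len: "length xs = Suc m" "length ys = Suc m"
    using * by (auto simp: A_def)
  \<comment> \<open>\<open>Poly\<close> forgets trailing zeros, but lists of equal length stay
    distinguishable.\<close>
  have "Poly xs - Poly ys \<noteq> 0"
  proof
    assume "Poly xs - Poly ys = 0"
    then have "nth_default 0 xs i = nth_default 0 ys i" for i
      by (metis coeff_Poly_eq eq_iff_diff_eq_0)
    then have "xs ! i = ys ! i" if "i < Suc m" for i
      using that len by (metis nth_default_nth)
    then have "xs = ys"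
      using len by (intro nth_equalityI) auto
    with * show False by simp
  qed
  moreover have "degree (Poly xs - Poly ys) \<le> m"
    using len by (intro degree_le) (auto simp: nth_default_def)
  moreover have "fls_annihilates \<theta> m (Poly xs - Poly ys)"
    unfolding fls_annihilates_def
  proof (intro allI impI)
    fix i assume i: "1 \<le> i \<and> i \<le> int m"
    have "F xs ! nat (i - 1) = F ys ! nat (i - 1)"
      using * by simp
    then show "(poly_to_fls (Poly xs - Poly ys) * \<theta>) $$ i = 0"
      using i by (simp add: F_def poly_to_fls_diff left_diff_distrib nat_less_iff)
  qed
  ultimately show ?thesis by blast
qed

text \<open>Up to scalars, these are the denominators of the continued fraction convergents of
  \<open>\<theta>\<close>; all orders \<open>m\<close> are collected in one set.\<close>

definition monic_denominators :: "'a::field fls \<Rightarrow> 'a poly set" where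
  "monic_denominators \<theta> = {L. lead_coeff L = 1 \<and>
     (\<exists>m. fls_annihilates \<theta> m L \<and> (\<forall>M. M \<noteq> 0 \<longrightarrow> fls_annihilates \<theta> m M \<longrightarrow> degree L \<le> degree M))}"

text \<open>If \<open>L\<close> and \<open>M\<close> have orders \<open>m \<le> m'\<close>, then
  \<open>L - M\<close> annihilates to order \<open>m\<close>. Its leading terms cancel, so
  minimality of \<open>L\<close> forces it to be 0.\<close>

lemma inj_on_degree_monic_denominators: "inj_on degree (monic_denominators \<theta>)"
proof -
  have aux: "L = M" if "degree L = degree M" "lead_coeff L = 1" "lead_coeff M = 1"
    "fls_annihilates \<theta> m L" "fls_annihilates \<theta> m' M" "m \<le> m'"
    "\<forall>M. M \<noteq> 0 \<longrightarrow> fls_annihilates \<theta> m M \<longrightarrow> degree L \<le> degree M" for L M m m'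
  proof (rule ccontr)
    assume "L \<noteq> M"
    then have "L - M \<noteq> 0"
      by simp
    have "fls_annihilates \<theta> m (L - M)"
      by (rule fls_annihilates_diff[OF that(4) fls_annihilates_mono[OF that(5,6)]])
    then have "degree L \<le> degree (L - M)"
      using that(7) \<open>L - M \<noteq> 0\<close> by blast
    moreover have "degree (L - M) \<le> degree L"
      using that(1) by (intro degree_diff_le) simp_all
    ultimately have "degree (L - M) = degree L"
      by (rule antisym[rotated])
    moreover have "coeff (L - M) (degree L) = 0"
      using that(2,3) unfolding that(1) by simp
    ultimately have "lead_coeff (L - M) = 0"
      by (simp only:)
    with \<open>L - M \<noteq> 0\<close> show False
      by (simp only: leading_coeff_0_iff)
  qed
  show ?thesis
  proof (rule inj_onI)
    fix L M assume L: "L \<in> monic_denominators \<theta>" and M: "M \<in> monic_denominators \<theta>"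
      and deg: "degree L = degree M"
    obtain m where m: "fls_annihilates \<theta> m L"
      "\<forall>M. M \<noteq> 0 \<longrightarrow> fls_annihilates \<theta> m M \<longrightarrow> degree L \<le> degree M" and lc: "lead_coeff L = 1"
      using L unfolding monic_denominators_def by blast
    obtain m' where m': "fls_annihilates \<theta> m' M"
      "\<forall>L. L \<noteq> 0 \<longrightarrow> fls_annihilates \<theta> m' L \<longrightarrow> degree M \<le> degree L" and lc': "lead_coeff M = 1"
      using M unfolding monic_denominators_def by blast
    show "L = M"
    proof (cases "m \<le> m'")
      case True
      show ?thesis
        by (rule aux[OF deg lc lc' m(1) m'(1) True m(2)])
    next
      case False
      then have "m' \<le> m"
        by simp
      show ?thesis
        by (rule aux[OF deg[symmetric] lc' lc m'(1) m(1) \<open>m' \<le> m\<close> m'(2), symmetric])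
    qed
  qed
qed

lemma ex_monic_denominator:
  fixes \<theta> :: "'a::{field,finite} fls"
  shows "\<exists>L\<in>monic_denominators \<theta>. degree L \<le> m \<and> fls_annihilates \<theta> m L"
proof -
  obtain L0 where L0: "L0 \<noteq> 0 \<and> fls_annihilates \<theta> m L0" "degree L0 \<le> m"
    using ex_fls_annihilates by blast
  obtain L where L: "L \<noteq> 0 \<and> fls_annihilates \<theta> m L"
    and min: "\<And>M. M \<noteq> 0 \<and> fls_annihilates \<theta> m M \<Longrightarrow> degree L \<le> degree M"
    using ex_has_least_nat[of "\<lambda>M. M \<noteq> 0 \<and> fls_annihilates \<theta> m M" L0 degree] L0(1) by auto
  define L' where "L' = smult (inverse (lead_coeff L)) L"
  have "fls_annihilates \<theta> m L'" "degree L' = degree L" "lead_coeff L' = 1"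
    using L by (auto simp: L'_def fls_annihilates_smult)
  moreover have "degree L \<le> m"
    using min[OF L0(1)] L0(2) by simp
  ultimately show ?thesis
    using min by (intro bexI[of _ L']) (auto simp: monic_denominators_def)
qed

text \<open>The equation for \<open>L\<close> of degree \<open>d\<close> can be solved for
  \<open>g d\<close> once the earlier values are fixed, since the leading coefficient is invertible;
  injectivity leaves at most one equation per \<open>d\<close>.\<close>

lemma ex_residues_eq_1:
  fixes S :: "'a::field poly set"
  assumes inj: "inj_on degree S" and nz: "0 \<notin> S"
  shows "\<exists>g. \<forall>L\<in>S. (\<Sum>j\<le>degree L. coeff L j * g j) = 1"
proof -
  \<comment> \<open>Here \<open>r\<close> is the candidate for \<open>g d\<close>; only the values
    of \<open>g\<close> below \<open>d\<close> enter, as recursive choice requires.\<close>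
  define P where "P g d r \<longleftrightarrow>
    (\<forall>L\<in>S. degree L = d \<longrightarrow> (\<Sum>j<d. coeff L j * g j) + coeff L d * r = 1)" for g d r
  have "\<exists>g. \<forall>d. P g d (g d)"
  proof (rule dependent_wf_choice[of less_than])
    fix g h :: "nat \<Rightarrow> 'a" and d r
    assume "\<And>z. (z, d) \<in> less_than \<Longrightarrow> g z = h z"
    then have "(\<Sum>j<d. coeff L j * g j) = (\<Sum>j<d. coeff L j * h j)" for L
      by (intro sum.cong) auto
    then show "P g d r = P h d r"
      by (simp add: P_def)
  next
    fix d and g :: "nat \<Rightarrow> 'a"
    show "\<exists>r. P g d r"
    proof (cases "\<exists>L\<in>S. degree L = d")
      case True
      then obtain L where L: "L \<in> S" "degree L = d" by blast
      have "P g d ((1 - (\<Sum>j<d. coeff L j * g j)) / coeff L d)"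
        unfolding P_def
      proof (intro ballI impI)
        fix M assume "M \<in> S" "degree M = d"
        then have "M = L"
          using L inj by (auto dest: inj_onD)
        then show "(\<Sum>j<d. coeff M j * g j)
            + coeff M d * ((1 - (\<Sum>j<d. coeff L j * g j)) / coeff L d) = 1"
          using L nz by auto
      qed
      then show ?thesis by blast
    qed (auto simp: P_def)
  qed simp
  then obtain g where g: "P g d (g d)" for d by blast
  have "(\<Sum>j\<le>degree L. coeff L j * g j) = 1" if "L \<in> S" for L
    using g[of "degree L"] that
    by (auto simp: P_def simp flip: lessThan_Suc_atMost)
  then show ?thesis by blast
qed

lemma ex_badly_approximable_shift:
  fixes \<theta> :: "'a::{field,finite} fls"
  shows "\<exists>\<gamma>. \<forall>N. N \<noteq> 0 \<longrightarrow> real CARD('a) powi (-2)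
           \<le> fls_abs (poly_to_fls N) * fls_abs (fls_frac (poly_to_fls N * \<theta> - \<gamma>))"
proof -
  have "0 \<notin> monic_denominators \<theta>"
    by (simp add: monic_denominators_def)
  then obtain g where g: "\<And>L. L \<in> monic_denominators \<theta> \<Longrightarrow> (\<Sum>j\<le>degree L. coeff L j * g j) = 1"
    using ex_residues_eq_1[OF inj_on_degree_monic_denominators] by blast
  \<comment> \<open>The factor \<open>fls_X\<close> places \<open>g 0\<close> at
    \<open>t^-1\<close>, so that the sums controlled by \<open>g\<close> are residues of
    \<open>L \<gamma>\<close>.\<close>
  define \<gamma> where "\<gamma> = fls_X * fps_to_fls (Abs_fps g)"
  have \<gamma>_nth: "\<gamma> $$ (1 + int l) = g l" for l
    by (simp add: \<gamma>_def fls_X_times_conv_shift)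
  have q: "0 < real CARD('a)"
    by simp
  have "real CARD('a) powi (-2)
      \<le> fls_abs (poly_to_fls N) * fls_abs (fls_frac (poly_to_fls N * \<theta> - \<gamma>))" if "N \<noteq> 0" for N
  proof (rule ccontr)
    define n where "n = degree N"
    assume "\<not> ?thesis"
    moreover have "real CARD('a) powi (-2) = real CARD('a) powi int n * real CARD('a) powi (- (int n + 2))"
      by (subst power_int_add [symmetric]) auto
    ultimately have "real CARD('a) powi int n * fls_abs (fls_frac (poly_to_fls N * \<theta> - \<gamma>))
        < real CARD('a) powi int n * real CARD('a) powi (- (int n + 2))"
      by (simp only: fls_abs_poly_to_fls[OF \<open>N \<noteq> 0\<close>] n_def not_le)
    then have "fls_abs (fls_frac (poly_to_fls N * \<theta> - \<gamma>)) < real CARD('a) powi (- (int n + 2))"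
      using q by (simp only: mult_less_cancel_left_pos zero_less_power_int)
    from fls_nth_eq_0_if_abs_frac_less[OF this]
    \<comment> \<open>The coefficients of \<open>t^-1\<close> to \<open>t^(-n-2)\<close> agree,
      which covers every \<open>l\<close> up to the largest possible degree \<open>n + 1\<close> of
      \<open>L\<close>.\<close>
    have eq: "g l = (\<Sum>j\<le>n. coeff N j * \<theta> $$ (1 + int l + int j))" if "l \<le> Suc n" for l
      using that \<gamma>_nth[of l] poly_to_fls_times_nth[of N n \<theta> "1 + int l"] n_def by force
    obtain L where L: "L \<in> monic_denominators \<theta>" "degree L \<le> Suc n" "fls_annihilates \<theta> (Suc n) L"
      using ex_monic_denominator by blast
    \<comment> \<open>The residue of \<open>L N \<theta>\<close> is computed in two orders; grouped
      by \<open>N\<close>, it involves only the first \<open>n + 1\<close> fractional coefficients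
      of \<open>L \<theta>\<close>, all 0.\<close>
    have "(\<Sum>l\<le>degree L. coeff L l * g l)
        = (\<Sum>l\<le>degree L. \<Sum>j\<le>n. coeff N j * (coeff L l * \<theta> $$ (1 + int j + int l)))"
      using L by (intro sum.cong) (auto simp: eq sum_distrib_left algebra_simps)
    also have "\<dots> = (\<Sum>j\<le>n. coeff N j * (poly_to_fls L * \<theta>) $$ (1 + int j))"
      by (subst sum.swap) (simp add: poly_to_fls_times_nth[OF order_refl] sum_distrib_left)
    also have "\<dots> = 0"
      using L by (intro sum.neutral) (auto simp: fls_annihilates_def)
    finally show False
      using g[OF L(1)] by simp
  qed
  then show ?thesis by blast
qed

subsection \<open>The upper bound\<close>

text \<open>The exponent \<open>2^0\<close> is omitted to make the residue 0, for the case of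
  \<open>\<gamma>\<close> without fractional part.\<close>

definition fls_lacunary :: "'a::zero_neq_one fls" where
  "fls_lacunary = fps_to_fls (Abs_fps (\<lambda>i. if \<exists>k\<ge>1. i = 2 ^ k then 1 else 0))"

lemma fls_lacunary_nth_power: "1 \<le> k \<Longrightarrow> fls_lacunary $$ (2 ^ k) = 1"
  by (auto simp: fls_lacunary_def nat_power_eq)

lemma fls_lacunary_nth_1: "fls_lacunary $$ 1 = 0"
proof -
  have "1 \<noteq> (2 :: nat) ^ k" if "k \<ge> 1" for k
    using one_less_power[of "2 :: nat" k] that by simp
  then show ?thesis
    by (auto simp: fls_lacunary_def)
qed

text \<open>These gaps provide the zeros on one side of the antidiagonal of the Hankel matrix of
  size \<open>2^k\<close>.\<close>

lemma fls_lacunary_nth_eq_0: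
  assumes "2 ^ k < i" "i < 2 ^ Suc k"
  shows "fls_lacunary $$ i = 0"
proof -
  have "nat i \<noteq> 2 ^ l" for l
  proof
    assume "nat i = 2 ^ l"
    then have "i = 2 ^ l"
      using order_less_trans[OF zero_less_power assms(1)] by (simp add: nat_eq_iff)
    then have "k < l" "l < Suc k"
      using assms by (simp_all add: power_strict_increasing_iff del: power_Suc)
    then show False by simp
  qed
  then show ?thesis
    by (simp add: fls_lacunary_def)
qed

text \<open>Numbering the equations by \<open>d = m - i\<close> turns the Hankel system into
  \<open>N P = G\<close> modulo \<open>X^m\<close> for power series. As \<open>P\<close> has
  constant term 1, \<open>N\<close> is \<open>G / P\<close> truncated below
  \<open>X^m\<close>.\<close>

lemma ex_poly_times_fls_lacunary:
  fixes \<gamma> :: "'a::field fls"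
  assumes "1 \<le> k"
  shows "\<exists>N. degree N < 2 ^ k \<and>
           (\<forall>i. 1 \<le> i \<and> i \<le> 2 ^ k \<longrightarrow> (poly_to_fls N * fls_lacunary) $$ i = \<gamma> $$ i)"
proof -
  define m :: nat where "m = 2 ^ k"
  have m: "int m = 2 ^ k" "0 < m"
    by (simp_all add: m_def)
  define P where "P = Abs_fps (\<lambda>i. fls_lacunary $$ (int m - int i) :: 'a)"
  define G where "G = Abs_fps (\<lambda>i. \<gamma> $$ (int m - int i))"
  have "P $ 0 = 1"
    using assms by (simp add: P_def m fls_lacunary_nth_power)
  then have PG: "(G * inverse P) * P = G"
    by (simp add: mult.assoc inverse_mult_eq_1)
  define N where "N = Abs_poly (\<lambda>j. if j < m then (G * inverse P) $ j else 0)"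
  have coeff_N: "coeff N j = (if j < m then (G * inverse P) $ j else 0)" for j
    unfolding N_def
    by (subst Abs_poly_inverse) (auto intro!: MOST_nat[THEN iffD2] exI[of _ m])
  have deg: "degree N \<le> m - 1"
    by (intro degree_le) (auto simp: coeff_N)
  have "(poly_to_fls N * fls_lacunary) $$ i = \<gamma> $$ i" if "1 \<le> i" "i \<le> 2 ^ k" for i
  proof -
    define d where "d = nat (int m - i)"
    have d: "i = int m - int d" "d < m"
      using that m by (auto simp: d_def)
    have "(poly_to_fls N * fls_lacunary) $$ i
        = (\<Sum>j\<le>m-1. coeff N j * fls_lacunary $$ (i + int j))"
      by (rule poly_to_fls_times_nth[OF deg])
    \<comment> \<open>For \<open>d < j < m\<close> the index \<open>i + j\<close> lies strictly
      between \<open>m\<close> and \<open>2 m\<close>, inside a gap.\<close>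
    also have "\<dots> = (\<Sum>j\<le>d. coeff N j * fls_lacunary $$ (i + int j))"
    proof (rule sum.mono_neutral_right)
      have "fls_lacunary $$ (i + int j) = (0 :: 'a)" if "j \<le> m - 1" "d < j" for j
      proof (rule fls_lacunary_nth_eq_0[of k])
        show "2 ^ k < i + int j" "i + int j < 2 ^ Suc k"
          unfolding power_Suc m(1)[symmetric] d(1) using that d(2) by auto
      qed
      then show "\<forall>j\<in>{..m-1} - {..d}. coeff N j * fls_lacunary $$ (i + int j) = 0"
        by auto
    qed (use d in auto)
    also have "\<dots> = (\<Sum>j=0..d. (G * inverse P) $ j * P $ (d - j))"
    proof (rule sum.cong)
      fix j assume "j \<in> {0..d}"
      then have "j \<le> d" "i + int j = int m - int (d - j)"
        using d by auto
      then show "coeff N j * fls_lacunary $$ (i + int j) = (G * inverse P) $ j * P $ (d - j)"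
        using d(2) by (simp only: coeff_N P_def fps_nth_Abs_fps) simp
    qed auto
    also have "\<dots> = G $ d"
      by (metis PG fps_mult_nth)
    finally show ?thesis
      using d by (simp add: G_def)
  qed
  moreover have "degree N < 2 ^ k"
    using deg m(2) unfolding m_def [symmetric] by linarith
  ultimately show ?thesis by blast
qed

lemma fls_lacunary_well_approximable:
  fixes \<gamma> :: "'a::{field,finite} fls"
  shows "\<exists>N. N \<noteq> 0 \<and> fls_abs (poly_to_fls N) * fls_abs (fls_frac (poly_to_fls N * fls_lacunary - \<gamma>))
           \<le> real CARD('a) powi (-2)"
proof (cases "\<exists>i\<ge>1. \<gamma> $$ i \<noteq> 0")
  case True
  then obtain i where i: "1 \<le> i" "\<gamma> $$ i \<noteq> 0" by blast
  \<comment> \<open>Since \<open>i < 2^i\<close>, the nonzero coefficient of \<open>\<gamma>\<close>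
    at \<open>i\<close> is among those matched, which forces \<open>N \<noteq> 0\<close>.\<close>
  define k where "k = nat i"
  have k: "1 \<le> k" "i \<le> 2 ^ k"
    using i of_nat_less_iff[where 'a = int, THEN iffD2, OF less_exp[of k]] by (auto simp: k_def)
  obtain N where N: "degree N < 2 ^ k"
    "\<forall>i. 1 \<le> i \<and> i \<le> 2 ^ k \<longrightarrow> (poly_to_fls N * fls_lacunary) $$ i = \<gamma> $$ i"
    using ex_poly_times_fls_lacunary[OF k(1)] by blast
  have "(poly_to_fls N * fls_lacunary) $$ i = \<gamma> $$ i"
    using N(2) i k by blast
  then have "N \<noteq> 0"
    using i by (auto simp: poly_to_fls_def)
  have q: "1 \<le> real CARD('a)"
    by (simp add: Suc_leI)
  have "fls_abs (poly_to_fls N) \<le> real CARD('a) powi (2 ^ k - 1)"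
  proof -
    have "int (degree N) < int (2 ^ k)"
      using N(1) by (simp only: of_nat_less_iff)
    then show ?thesis
      using q unfolding fls_abs_poly_to_fls[OF \<open>N \<noteq> 0\<close>] by (intro power_int_increasing) auto
  qed
  moreover have "fls_abs (fls_frac (poly_to_fls N * fls_lacunary - \<gamma>))
      \<le> real CARD('a) powi (- int (2 ^ k) - 1)"
    using N(2) by (intro fls_abs_frac_le) auto
  ultimately have "fls_abs (poly_to_fls N) * fls_abs (fls_frac (poly_to_fls N * fls_lacunary - \<gamma>))
      \<le> real CARD('a) powi (2 ^ k - 1) * real CARD('a) powi (- int (2 ^ k) - 1)"
    by (intro mult_mono fls_abs_nonneg) auto
  also have "\<dots> = real CARD('a) powi (-2)"
    by (simp flip: power_int_add)
  finally show ?thesis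
    using \<open>N \<noteq> 0\<close> by blast
next
  case False
  have "fls_abs (fls_frac (poly_to_fls 1 * fls_lacunary - \<gamma>)) \<le> real CARD('a) powi (- int 1 - 1)"
  proof (rule fls_abs_frac_le)
    fix i :: int assume "1 \<le> i" "i \<le> int 1"
    then have "i = 1" by simp
    then show "(poly_to_fls 1 * fls_lacunary - \<gamma>) $$ i = 0"
      using False by (simp add: poly_to_fls_def fls_lacunary_nth_1)
  qed
  then show ?thesis
    by (intro exI[of _ 1]) (simp add: fls_abs_one)
qed

section \<open>The two bounds combined into the value of the infimum\<close>

theorem theorem3p9:
  shows "(INF \<theta> :: 'a::{field,finite} fls. SUP \<gamma> :: 'a fls. INF N \<in> {N :: 'a poly. N \<noteq> 0}.
            fls_abs (poly_to_fls N) * fls_abs (fls_frac (poly_to_fls N * \<theta> - \<gamma>)))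
          = real CARD('a) powi (-2)"
proof -
  define c where "c = real CARD('a) powi (-2)"
  define v where "v \<theta> \<gamma> N = fls_abs (poly_to_fls N) * fls_abs (fls_frac (poly_to_fls N * \<theta> - \<gamma>))"
    for \<theta> \<gamma> :: "'a fls" and N
  define w where "w \<theta> \<gamma> = (INF N \<in> {N. N \<noteq> 0}. v \<theta> \<gamma> N)" for \<theta> \<gamma>
  have bdd: "bdd_below (v \<theta> \<gamma> ` A)" for \<theta> \<gamma> A
    by (rule bdd_belowI[of _ 0]) (auto simp: v_def fls_abs_nonneg)
  have w_le: "w \<theta> \<gamma> \<le> v \<theta> \<gamma> N" if "N \<noteq> 0" for \<theta> \<gamma> N
    unfolding w_def using that by (intro cINF_lower bdd) auto
  \<comment> \<open>\<open>N = 1\<close> gives the uniform bound that makes the supremum over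
    \<open>\<gamma>\<close> meaningful.\<close>
  have "w \<theta> \<gamma> \<le> 1" for \<theta> \<gamma>
    using order_trans[OF w_le[of 1 \<theta> \<gamma>]] by (simp add: v_def fls_abs_one fls_abs_frac_le_1)
  then have bdd_w: "bdd_above (range (w \<theta>))" for \<theta>
    by (intro bdd_aboveI[of _ 1]) auto
  have lower: "c \<le> (SUP \<gamma>. w \<theta> \<gamma>)" for \<theta>
  proof -
    obtain \<gamma> where "\<And>N. N \<noteq> 0 \<Longrightarrow> c \<le> v \<theta> \<gamma> N"
      using ex_badly_approximable_shift[of \<theta>] unfolding c_def v_def by blast
    then have "c \<le> w \<theta> \<gamma>"
      unfolding w_def by (intro cINF_greatest) (auto intro: exI[of _ 1])
    then show ?thesis
      by (intro cSUP_upper2[OF bdd_w]) auto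
  qed
  have "w fls_lacunary \<gamma> \<le> c" for \<gamma>
    using fls_lacunary_well_approximable[of \<gamma>] order_trans[OF w_le, of _ fls_lacunary \<gamma>]
    unfolding c_def v_def by blast
  then have "(SUP \<gamma>. w fls_lacunary \<gamma>) \<le> c"
    by (rule cSUP_least[OF UNIV_not_empty])
  moreover have "bdd_below (range (\<lambda>\<theta>. SUP \<gamma>. w \<theta> \<gamma>))"
    by (rule bdd_belowI[of _ c]) (auto intro: lower)
  ultimately have "(INF \<theta>. SUP \<gamma>. w \<theta> \<gamma>) \<le> c"
    by (rule cINF_lower2[OF _ UNIV_I, rotated])
  moreover have "c \<le> (INF \<theta>. SUP \<gamma>. w \<theta> \<gamma>)"
    by (rule cINF_greatest[OF UNIV_not_empty lower])
  ultimately show ?thesis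
    by (simp add: w_def v_def c_def)
qed

end
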